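(* Let $X,Y,Z$ be Polish spaces, and let $K: X\rightsquigarrow Y$ and $L: X\rightsquigarrow Z$ be stochastic relations which are both epimorphisms with respect to Kleisli composition. Then the following conditions are equivalent: (1) $K\approx L$. (2) There exists a Borel isomorphism $f: Y\to Z$ such that $L(x)(C)=K(x)(f^{-1}[C])$ for all $x\in X$ and all Borel sets $C\subseteq Z$.
   Context: A stochastic relation $K: X\rightsquigarrow Y$ between Polish spaces assigns to each $x\in X$ a subprobability measure $K(x)$ on the Borel sets $\mathcal{B}(Y)$ such that $x\mapsto K(x)(B)$ is Borel measurable for every $B\in\mathcal{B}(Y)$. Kleisli composition (convolution) of $K: X\rightsquigarrow Y$ and $L: Y\rightsquigarrow Z$ is the stochastic relation $L*K: X\rightsquigarrow Z$ given by $(L*K)(x)(C)=\int_Y L(y)(C)\,K(x)(dy)$. $K: X\rightsquigarrow Y$ is an epimorphism iff for all Polish spaces $W$ and all stochastic relations $L_1,L_2: Y\rightsquigarrow W$, $L_1*K=L_2*K$ implies $L_1=L_2$. For epimorphisms $K: X\rightsquigarrow Y$ and $L: X\rightsquigarrow Z$ write $K\le L$ iff there is a stochastic relation $J: Z\rightsquigarrow Y$ with $K=J*L$, and write $K\approx L$ iff $K\le L$ and $L\le K$. A Borel isomorphism is a Borel measurable bijection with Borel measurable inverse. *)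

theory Defs
  imports "HOL-Probability.Probability"
begin

definition Polish_space :: "'a topology \<Rightarrow> bool" where
  "Polish_space X \<longleftrightarrow> completely_metrizable_space X \<and> separable_space X"

definition borel_of :: "'a topology \<Rightarrow> 'a measure" where
  "borel_of X = sigma (topspace X) {U. openin X U}"

lemma space_borel_of [simp]: "space (borel_of X) = topspace X"
  unfolding borel_of_def by (rule space_measure_of) (auto dest: openin_subset)

lemma sets_borel_of: "sets (borel_of X) = sigma_sets (topspace X) {U. openin X U}"
  unfolding borel_of_def by (rule sets_measure_of) (auto dest: openin_subset)

lemma borel_of_euclidean: "sets (borel_of euclidean) = sets borel"
  by (simp add: sets_borel_of borel_def)

lemma topspace_in_borel_of [simp]: "topspace X \<in> sets (borel_of X)"
  using sets.top[of "borel_of X"] by simp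

lemma continuous_map_measurable_borel_of:
  assumes "continuous_map X Y f"
  shows "f \<in> borel_of X \<rightarrow>\<^sub>M borel_of Y"
  unfolding borel_of_def[of Y]
proof (rule measurable_measure_of)
  show "{U. openin Y U} \<subseteq> Pow (topspace Y)" by (auto dest: openin_subset)
  show "f \<in> space (borel_of X) \<rightarrow> topspace Y"
    using assms by (auto simp: continuous_map_def)
  fix U assume "U \<in> {U. openin Y U}"
  then have "openin X {x \<in> topspace X. f x \<in> U}"
    using assms by (auto simp: continuous_map_def)
  moreover have "f -` U \<inter> space (borel_of X) = {x \<in> topspace X. f x \<in> U}" by auto
  ultimately show "f -` U \<inter> space (borel_of X) \<in> sets (borel_of X)"
    by (auto simp: sets_borel_of)
qed

definition borel_isomorphism :: "'a topology \<Rightarrow> 'b topology \<Rightarrow> ('a \<Rightarrow> 'b) \<Rightarrow> bool" where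
  "borel_isomorphism X Y f \<longleftrightarrow>
     bij_betw f (topspace X) (topspace Y) \<and>
     f \<in> borel_of X \<rightarrow>\<^sub>M borel_of Y \<and>
     the_inv_into (topspace X) f \<in> borel_of Y \<rightarrow>\<^sub>M borel_of X"

text \<open>
  The library predicate \<open>subprob_space\<close> requires a nonempty underlying space, so the Giry monad has
  no kernel from a nonempty space into the empty one. The definition below admits that (zero)
  kernel; the lemmas \<open>stochastic_relation_iff_measurable\<close> and \<open>kleisli_eq_bind\<close> show that for
  a nonempty codomain it is the library notion. The values of a kernel outside \<open>topspace X\<close> are
  irrelevant.
\<close>

definition stochastic_relation :: "'a topology \<Rightarrow> 'b topology \<Rightarrow> ('a \<Rightarrow> 'b measure) \<Rightarrow> bool" where
  "stochastic_relation X Y K \<longleftrightarrow>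
     (\<forall>x\<in>topspace X. sets (K x) = sets (borel_of Y) \<and> emeasure (K x) (topspace Y) \<le> 1) \<and>
     (\<forall>B\<in>sets (borel_of Y). (\<lambda>x. emeasure (K x) B) \<in> borel_measurable (borel_of X))"

text \<open>\<open>kleisli Z L K\<close> is \<open>L * K\<close>; the target space is an argument since it cannot be read off \<open>L\<close>
  when the middle space is empty.\<close>

definition kleisli :: "'c topology \<Rightarrow> ('b \<Rightarrow> 'c measure) \<Rightarrow> ('a \<Rightarrow> 'b measure) \<Rightarrow> 'a \<Rightarrow> 'c measure" where
  "kleisli Z L K x =
     measure_of (topspace Z) (sets (borel_of Z)) (\<lambda>C. \<integral>\<^sup>+ y. emeasure (L y) C \<partial>K x)"

text \<open>
  A definition cannot quantify over types, so the test spaces \<open>W\<close> are the Polish topologies whose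
  points are real numbers: any set of reals with any Polish topology, unrelated to the usual one. As a Polish
  space has at most continuum many points, this covers every Polish space up to homeomorphism;
  lemma \<open>epimorphism_cancel\<close> gives the cancellation property for Polish spaces over any type.
\<close>

definition epimorphism :: "'a topology \<Rightarrow> 'b topology \<Rightarrow> ('a \<Rightarrow> 'b measure) \<Rightarrow> bool" where
  "epimorphism X Y K \<longleftrightarrow>
     (\<forall>(W :: real topology) L1 L2.
        Polish_space W \<longrightarrow> stochastic_relation Y W L1 \<longrightarrow> stochastic_relation Y W L2 \<longrightarrow>
        (\<forall>x\<in>topspace X. kleisli W L1 K x = kleisli W L2 K x) \<longrightarrow>
        (\<forall>y\<in>topspace Y. L1 y = L2 y))"

definition relation_le ::
    "'a topology \<Rightarrow> 'b topology \<Rightarrow> 'c topology \<Rightarrow> ('a \<Rightarrow> 'b measure) \<Rightarrow> ('a \<Rightarrow> 'c measure) \<Rightarrow> bool" where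
  "relation_le X Y Z K L \<longleftrightarrow>
     (\<exists>J. stochastic_relation Z Y J \<and> (\<forall>x\<in>topspace X. K x = kleisli Y J L x))"

definition relation_equiv ::
    "'a topology \<Rightarrow> 'b topology \<Rightarrow> 'c topology \<Rightarrow> ('a \<Rightarrow> 'b measure) \<Rightarrow> ('a \<Rightarrow> 'c measure) \<Rightarrow> bool" where
  "relation_equiv X Y Z K L \<longleftrightarrow> relation_le X Y Z K L \<and> relation_le X Z Y L K"

lemma stochastic_relation_iff_measurable:
  assumes "topspace Y \<noteq> {}"
  shows "stochastic_relation X Y K \<longleftrightarrow> K \<in> borel_of X \<rightarrow>\<^sub>M subprob_algebra (borel_of Y)"
proof
  assume K: "stochastic_relation X Y K"
  show "K \<in> borel_of X \<rightarrow>\<^sub>M subprob_algebra (borel_of Y)"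
  proof (rule measurable_subprob_algebra)
    fix x assume "x \<in> space (borel_of X)"
    then have s: "sets (K x) = sets (borel_of Y)" and "emeasure (K x) (topspace Y) \<le> 1"
      using K by (auto simp: stochastic_relation_def)
    then show "subprob_space (K x)"
      using assms sets_eq_imp_space_eq[OF s] by (intro subprob_spaceI) auto
    show "sets (K x) = sets (borel_of Y)" by (rule s)
  qed (use K in \<open>auto simp: stochastic_relation_def\<close>)
next
  assume K: "K \<in> borel_of X \<rightarrow>\<^sub>M subprob_algebra (borel_of Y)"
  have "sets (K x) = sets (borel_of Y) \<and> emeasure (K x) (topspace Y) \<le> 1" if "x \<in> topspace X" for x
  proof -
    have x: "x \<in> space (borel_of X)" using that by simp
    have s: "sets (K x) = sets (borel_of Y)" by (rule sets_kernel[OF K x])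
    interpret subprob_space "K x" by (rule subprob_space_kernel[OF K x])
    show ?thesis using s emeasure_space_le_1 sets_eq_imp_space_eq[OF s] by simp
  qed
  then show "stochastic_relation X Y K"
    using measurable_emeasure_kernel[OF K] by (auto simp: stochastic_relation_def)
qed

lemma space_kleisli [simp]: "space (kleisli Z L K x) = topspace Z"
  unfolding kleisli_def using sets.space_closed[of "borel_of Z"] by (simp add: space_measure_of)

lemma sets_kleisli [simp]: "sets (kleisli Z L K x) = sets (borel_of Z)"
  unfolding kleisli_def
  using sets.space_closed[of "borel_of Z"] sets.sigma_sets_eq[of "borel_of Z"]
  by (simp add: sets_measure_of)

lemma emeasure_kleisli:
  assumes K: "stochastic_relation X Y K" and L: "stochastic_relation Y Z L"
    and x: "x \<in> topspace X" and C: "C \<in> sets (borel_of Z)"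
  shows "emeasure (kleisli Z L K x) C = (\<integral>\<^sup>+ y. emeasure (L y) C \<partial>K x)"
  unfolding kleisli_def
proof (rule emeasure_measure_of_sigma)
  have s: "sets (K x) = sets (borel_of Y)"
    using K x by (auto simp: stochastic_relation_def)
  have sL: "sets (L y) = sets (borel_of Z)" if "y \<in> space (K x)" for y
    using L that sets_eq_imp_space_eq[OF s] by (auto simp: stochastic_relation_def)
  have m: "(\<lambda>y. emeasure (L y) A) \<in> borel_measurable (K x)" if "A \<in> sets (borel_of Z)" for A
    unfolding measurable_cong_sets[OF s refl] using L that by (simp add: stochastic_relation_def)
  show "sigma_algebra (topspace Z) (sets (borel_of Z))"
    using sets.sigma_algebra_axioms[of "borel_of Z"] by simp
  show "positive (sets (borel_of Z)) (\<lambda>C. \<integral>\<^sup>+ y. emeasure (L y) C \<partial>K x)"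
    by (simp add: positive_def)
  show "countably_additive (sets (borel_of Z)) (\<lambda>C. \<integral>\<^sup>+ y. emeasure (L y) C \<partial>K x)"
  proof (rule countably_additiveI)
    fix A :: "nat \<Rightarrow> _" assume A: "range A \<subseteq> sets (borel_of Z)" "disjoint_family A"
    have "(\<Sum>i. \<integral>\<^sup>+ y. emeasure (L y) (A i) \<partial>K x) = (\<integral>\<^sup>+ y. (\<Sum>i. emeasure (L y) (A i)) \<partial>K x)"
      using A m by (intro nn_integral_suminf[symmetric]) auto
    also have "\<dots> = (\<integral>\<^sup>+ y. emeasure (L y) (\<Union>i. A i) \<partial>K x)"
      using A sL by (intro nn_integral_cong suminf_emeasure) auto
    finally show "(\<Sum>i. \<integral>\<^sup>+ y. emeasure (L y) (A i) \<partial>K x) = (\<integral>\<^sup>+ y. emeasure (L y) (\<Union>i. A i) \<partial>K x)" .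
  qed
qed (rule C)

lemma kleisli_eq_bind:
  assumes K: "stochastic_relation X Y K" and L: "stochastic_relation Y Z L"
    and x: "x \<in> topspace X" and Y: "topspace Y \<noteq> {}" and Z: "topspace Z \<noteq> {}"
  shows "kleisli Z L K x = K x \<bind> L"
proof (rule measure_eqI)
  have s: "sets (K x) = sets (borel_of Y)"
    using K x by (auto simp: stochastic_relation_def)
  have ne: "space (K x) \<noteq> {}" using Y sets_eq_imp_space_eq[OF s] by simp
  have L': "L \<in> K x \<rightarrow>\<^sub>M subprob_algebra (borel_of Z)"
    using L stochastic_relation_iff_measurable[OF Z] unfolding measurable_cong_sets[OF s refl] by blast
  show "sets (kleisli Z L K x) = sets (K x \<bind> L)"
    using sets_bind_measurable[OF L' ne] by simp
  fix C assume "C \<in> sets (kleisli Z L K x)"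
  then show "emeasure (kleisli Z L K x) C = emeasure (K x \<bind> L) C"
    using emeasure_bind[OF ne L'] emeasure_kleisli[OF K L x] by simp
qed

lemma stochastic_relation_kleisli:
  assumes K: "stochastic_relation X Y K" and L: "stochastic_relation Y Z L"
  shows "stochastic_relation X Z (kleisli Z L K)"
proof -
  have "emeasure (kleisli Z L K x) (topspace Z) \<le> 1" if x: "x \<in> topspace X" for x
  proof -
    have "sets (K x) = sets (borel_of Y)" and le: "emeasure (K x) (topspace Y) \<le> 1"
      using K x by (auto simp: stochastic_relation_def)
    then have s: "space (K x) = topspace Y"
      using sets_eq_imp_space_eq[of "K x" "borel_of Y"] by simp
    have "emeasure (kleisli Z L K x) (topspace Z) = (\<integral>\<^sup>+ y. emeasure (L y) (topspace Z) \<partial>K x)"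
      by (rule emeasure_kleisli[OF K L x]) simp
    also have "\<dots> \<le> (\<integral>\<^sup>+ y. 1 \<partial>K x)"
      by (rule nn_integral_mono) (use L in \<open>simp add: s stochastic_relation_def\<close>)
    finally show ?thesis using le s by simp
  qed
  moreover have "(\<lambda>x. emeasure (kleisli Z L K x) C) \<in> borel_measurable (borel_of X)"
    if C: "C \<in> sets (borel_of Z)" for C
  proof -
    have "(\<lambda>x. \<integral>\<^sup>+ y. emeasure (L y) C \<partial>K x) \<in> borel_measurable (borel_of X)"
    proof (cases "topspace Y = {}")
      case True
      have "(\<integral>\<^sup>+ y. emeasure (L y) C \<partial>K x) = 0" if x: "x \<in> space (borel_of X)" for x
      proof (rule nn_integral_empty)
        have "sets (K x) = sets (borel_of Y)"
          using K x by (simp add: stochastic_relation_def)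
        then show "space (K x) = {}"
          using True sets_eq_imp_space_eq[of "K x" "borel_of Y"] by simp
      qed
      then show ?thesis
        using measurable_cong[of "borel_of X" "\<lambda>x. \<integral>\<^sup>+ y. emeasure (L y) C \<partial>K x" "\<lambda>_. 0" borel]
          borel_measurable_const[of 0 "borel_of X"] by blast
    next
      case False
      then have K': "K \<in> borel_of X \<rightarrow>\<^sub>M subprob_algebra (borel_of Y)"
        using K by (simp add: stochastic_relation_iff_measurable)
      have "(\<lambda>y. emeasure (L y) C) \<in> borel_measurable (borel_of Y)"
        using L C by (auto simp: stochastic_relation_def)
      from measurable_compose[OF K' nn_integral_measurable_subprob_algebra[OF this]]
      show ?thesis .
    qed
    then show ?thesis
      by (subst measurable_cong[where g = "\<lambda>x. \<integral>\<^sup>+ y. emeasure (L y) C \<partial>K x"])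
         (auto simp: emeasure_kleisli[OF K L _ C])
  qed
  ultimately show ?thesis by (auto simp: stochastic_relation_def)
qed

lemma Polish_space_lepoll_real:
  assumes "Polish_space W"
  shows "topspace W \<lesssim> (UNIV :: real set)"
proof -
  obtain M d where "Metric_space M d" and W: "W = Metric_space.mtopology M d"
    using assms by (auto simp: Polish_space_def completely_metrizable_space_def)
  then interpret Metric_space M d by simp
  obtain C where C: "countable C" "C \<subseteq> M" "mtopology closure_of C = M"
    using assms by (auto simp: Polish_space_def separable_space_def W)
  define D where "D = C \<times> (UNIV :: nat set)"
  define h where "h = (\<lambda>x. to_nat_on D ` {(c, n). c \<in> C \<and> d c x < inverse (Suc n)})"
  have D: "countable D" using C by (simp add: D_def)
  have "inj_on h M"
  proof (rule inj_onI, rule ccontr)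
    fix x y assume xy: "x \<in> M" "y \<in> M" "h x = h y" "x \<noteq> y"
    have "{(c, n). c \<in> C \<and> d c x < inverse (Suc n)} = {(c, n). c \<in> C \<and> d c y < inverse (Suc n)}"
      using xy(3) inj_on_to_nat_on[OF D] unfolding h_def
      by (subst (asm) inj_on_image_eq_iff) (auto simp: D_def)
    then have eq: "d c x < inverse (Suc n) \<longleftrightarrow> d c y < inverse (Suc n)" if "c \<in> C" for c n
      using that by auto
    have "d x y / 2 > 0" using xy by simp
    then obtain n where n: "inverse (Suc n) < d x y / 2" using reals_Archimedean by blast
    have "x \<in> mtopology closure_of C" using C xy by simp
    moreover have "(0 :: real) < inverse (Suc n)" by simp
    ultimately obtain c where c: "c \<in> C" "c \<in> mball x (inverse (Suc n))"
      unfolding metric_closure_of by blast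
    have dx: "d c x < inverse (Suc n)" using c by (metis commute in_mball)
    have dy: "d c y < inverse (Suc n)" using eq[OF c(1)] dx by blast
    have "d x y \<le> d c x + d c y"
      using triangle[of x c y] c(1) C(2) xy(1,2) by (metis commute subsetD)
    then show False using n dx dy by linarith
  qed
  then have "topspace W \<lesssim> (UNIV :: nat set set)" by (auto simp: lepoll_def W)
  then show ?thesis
    using lepoll_trans eqpoll_imp_lepoll[OF nat_sets_eqpoll_reals] by blast
qed

lemma Polish_space_homeomorphic_real_topology:
  assumes "Polish_space W"
  obtains W' :: "real topology" and g where "Polish_space W'" "homeomorphic_map W W' g"
proof -
  obtain g :: "_ \<Rightarrow> real" where g: "inj_on g (topspace W)"
    using Polish_space_lepoll_real[OF assms] by (auto simp: lepoll_def)
  define h where "h = the_inv_into (topspace W) g"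
  define W' where "W' = pullback_topology (g ` topspace W) h W"
  have hg: "h (g x) = x" if "x \<in> topspace W" for x
    using g that by (simp add: h_def the_inv_into_f_f)
  have op: "openin W' U \<longleftrightarrow> (\<exists>V. openin W V \<and> U = g ` V)" for U
  proof -
    have "h -` V \<inter> g ` topspace W = g ` V" if "openin W V" for V
      using openin_subset[OF that] hg by force
    then show ?thesis unfolding W'_def openin_pullback_topology by metis
  qed
  have top: "topspace W' = g ` topspace W"
    using hg by (auto simp: W'_def topspace_pullback_topology)
  have hom: "homeomorphic_map W W' g"
  proof (rule bijective_open_imp_homeomorphic_map)
    have "{x \<in> topspace W. g x \<in> g ` V} = V" if "openin W V" for V
      using openin_subset[OF that] g by (auto simp: inj_on_def)
    then show "continuous_map W W' g" by (auto simp: continuous_map_def top op)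
    show "open_map W W' g" by (auto simp: open_map_def op)
  qed (use g top in auto)
  have "W homeomorphic_space W'" using hom homeomorphic_map_imp_homeomorphic_space by blast
  then have "Polish_space W'"
    using assms homeomorphic_completely_metrizable_space homeomorphic_separable_space
    by (auto simp: Polish_space_def)
  then show ?thesis using hom that by blast
qed

lemma epimorphism_cancel:
  fixes W :: "'w topology"
  assumes epi: "epimorphism X Y K" and K: "stochastic_relation X Y K" and W: "Polish_space W"
    and L1: "stochastic_relation Y W L1" and L2: "stochastic_relation Y W L2"
    and eq: "\<And>x. x \<in> topspace X \<Longrightarrow> kleisli W L1 K x = kleisli W L2 K x"
    and y: "y \<in> topspace Y"
  shows "L1 y = L2 y"
proof -
  obtain W' :: "real topology" and g where W': "Polish_space W'" and g: "homeomorphic_map W W' g"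
    using Polish_space_homeomorphic_real_topology[OF W] .
  obtain h where gh: "homeomorphic_maps W W' g h" using g by (auto simp: homeomorphic_map_maps)
  have gm: "g \<in> borel_of W \<rightarrow>\<^sub>M borel_of W'" and hm: "h \<in> borel_of W' \<rightarrow>\<^sub>M borel_of W"
    using gh by (auto simp: homeomorphic_maps_def intro: continuous_map_measurable_borel_of)
  have hg: "h (g w) = w" if "w \<in> topspace W" for w
    using gh that by (auto simp: homeomorphic_maps_def)
  define T where "T L z = distr (L z) (borel_of W') g" for L and z :: 'b
  have em: "emeasure (T L z) B = emeasure (L z) (g -` B \<inter> topspace W)"
    if "stochastic_relation Y W L" "z \<in> topspace Y" "B \<in> sets (borel_of W')" for L z B
  proof -
    have s: "sets (L z) = sets (borel_of W)"
      using that by (auto simp: stochastic_relation_def)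
    have "g \<in> L z \<rightarrow>\<^sub>M borel_of W'" unfolding measurable_cong_sets[OF s refl] by (rule gm)
    then show ?thesis
      using that(3) sets_eq_imp_space_eq[OF s] by (simp add: T_def emeasure_distr)
  qed
  have T: "stochastic_relation Y W' (T L)" if L: "stochastic_relation Y W L" for L
  proof -
    have "emeasure (T L z) (topspace W') \<le> 1" if z: "z \<in> topspace Y" for z
    proof -
      have "g -` topspace W' \<inter> topspace W = topspace W"
        using measurable_space[OF gm] by auto
      then show ?thesis using em[OF L z] L z by (auto simp: stochastic_relation_def)
    qed
    moreover have "(\<lambda>z. emeasure (T L z) B) \<in> borel_measurable (borel_of Y)"
      if B: "B \<in> sets (borel_of W')" for B
    proof -
      have "g -` B \<inter> topspace W \<in> sets (borel_of W)" using measurable_sets[OF gm B] by simp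
      then have "(\<lambda>z. emeasure (L z) (g -` B \<inter> topspace W)) \<in> borel_measurable (borel_of Y)"
        using L by (auto simp: stochastic_relation_def)
      then show ?thesis
        by (subst measurable_cong[OF em[OF L _ B]]) auto
    qed
    ultimately show ?thesis by (auto simp: stochastic_relation_def T_def)
  qed
  have "kleisli W' (T L1) K x = kleisli W' (T L2) K x" if x: "x \<in> topspace X" for x
  proof (rule measure_eqI)
    fix B assume "B \<in> sets (kleisli W' (T L1) K x)"
    then have B: "B \<in> sets (borel_of W')" by simp
    then have A: "g -` B \<inter> topspace W \<in> sets (borel_of W)" using measurable_sets[OF gm B] by simp
    have "emeasure (kleisli W' (T L) K x) B = emeasure (kleisli W L K x) (g -` B \<inter> topspace W)"
      if L: "stochastic_relation Y W L" for L
    proof -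
      have "sets (K x) = sets (borel_of Y)"
        using K x unfolding stochastic_relation_def by blast
      then have s: "space (K x) = topspace Y"
        using sets_eq_imp_space_eq[of "K x" "borel_of Y"] by simp
      show ?thesis
        unfolding emeasure_kleisli[OF K T[OF L] x B] emeasure_kleisli[OF K L x A]
        by (rule nn_integral_cong) (simp only: s em[OF L _ B])
    qed
    then show "emeasure (kleisli W' (T L1) K x) B = emeasure (kleisli W' (T L2) K x) B"
      using L1 L2 eq[OF x] by simp
  qed simp
  then have TT: "T L1 y = T L2 y"
    using epi W' T[OF L1] T[OF L2] y unfolding epimorphism_def by blast
  show ?thesis
  proof (rule measure_eqI)
    show "sets (L1 y) = sets (L2 y)" using L1 L2 y by (auto simp: stochastic_relation_def)
    fix A assume "A \<in> sets (L1 y)"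
    then have A: "A \<in> sets (borel_of W)" using L1 y by (auto simp: stochastic_relation_def)
    define B where "B = h -` A \<inter> topspace W'"
    have B: "B \<in> sets (borel_of W')" using measurable_sets[OF hm A] by (simp add: B_def)
    have "g -` B \<inter> topspace W = A"
      using hg measurable_space[OF gm] sets.sets_into_space[OF A] by (auto simp: B_def)
    then show "emeasure (L1 y) A = emeasure (L2 y) A"
      using em[OF L1 y B] em[OF L2 y B] TT by simp
  qed
qed

end

theory Submission
  imports Defs
begin

text \<open>
  If \<open>K = J * L\<close> and \<open>L = J' * K\<close>, cancelling the epimorphisms shows that \<open>J\<close> and \<open>J'\<close> are mutually
  inverse. Invertible relations are deterministic: \<open>\<integral> J(z)({y}) J'(y)(dz) = 1\<close> forces
  \<open>J(z) = \<delta>\<^sub>y\<close> for \<open>J'(y)\<close>-almost all \<open>z\<close>, in particular for some \<open>z\<close>; symmetrically \<open>J'(y') = \<delta>\<^sub>z\<close> for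
  \<open>J(z)\<close>-almost all \<open>y'\<close>, and since \<open>J(z) = \<delta>\<^sub>y\<close> this includes \<open>y' = y\<close>.
\<close>

section \<open>Elementary facts on stochastic relations and point masses\<close>

lemma stochastic_relation_sets:
  "stochastic_relation X Y K \<Longrightarrow> x \<in> topspace X \<Longrightarrow> sets (K x) = sets (borel_of Y)"
  by (simp add: stochastic_relation_def)

lemma stochastic_relation_space:
  "stochastic_relation X Y K \<Longrightarrow> x \<in> topspace X \<Longrightarrow> space (K x) = topspace Y"
  using stochastic_relation_sets sets_eq_imp_space_eq space_borel_of by metis

lemma stochastic_relation_le_1:
  assumes "stochastic_relation X Y K" "x \<in> topspace X"
  shows "emeasure (K x) B \<le> 1"
  using assms emeasure_space[of "K x" B] stochastic_relation_space[OF assms]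
  by (auto simp: stochastic_relation_def intro: order_trans)

lemma stochastic_relation_measurable:
  "stochastic_relation X Y K \<Longrightarrow> B \<in> sets (borel_of Y) \<Longrightarrow>
    (\<lambda>x. emeasure (K x) B) \<in> borel_measurable (borel_of X)"
  by (simp add: stochastic_relation_def)

text \<open>Points are closed because Polish spaces are metrizable. This lets a point mass be
  recognised by its value at its own point.\<close>

lemma singleton_in_borel_of:
  assumes "Polish_space X" "x \<in> topspace X"
  shows "{x} \<in> sets (borel_of X)"
proof -
  have "t1_space X"
    using assms by (simp add: Polish_space_def completely_metrizable_imp_metrizable_space
        metrizable_imp_t1_space)
  then have "openin X (topspace X - {x})"
    using assms by (metis closedin_t1_singleton openin_diff openin_topspace)
  then have "topspace X - {x} \<in> sets (borel_of X)" by (auto simp: sets_borel_of)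
  then have "topspace X - (topspace X - {x}) \<in> sets (borel_of X)" by (rule sets.Diff[rotated]) simp
  then show ?thesis using assms by (simp add: double_diff)
qed

lemma return_borel_of_inj:
  assumes "Polish_space X" "x \<in> topspace X" "y \<in> topspace X"
    and "return (borel_of X) x = return (borel_of X) y"
  shows "x = y"
  using arg_cong[OF assms(4), of "\<lambda>M. emeasure M {x}"] singleton_in_borel_of[OF assms(1,2)]
  by (simp add: indicator_def split: if_splits)

lemma stochastic_relation_return:
  assumes "f \<in> borel_of X \<rightarrow>\<^sub>M borel_of Y"
  shows "stochastic_relation X Y (\<lambda>x. return (borel_of Y) (f x))"
  using assms by (auto simp: stochastic_relation_def indicator_def intro: measurable_compose)

text \<open>A point mass takes only the values 0 and 1, so the preimage of \<open>C\<close> under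
  \<open>f\<close> is the set where \<open>emeasure (K x) C\<close> equals 1. Measurability of
  \<open>f\<close> is thus inherited from the relation.\<close>

lemma measurable_if_return_relation:
  assumes K: "stochastic_relation X Y K"
    and f: "\<And>x. x \<in> topspace X \<Longrightarrow> f x \<in> topspace Y \<and> K x = return (borel_of Y) (f x)"
  shows "f \<in> borel_of X \<rightarrow>\<^sub>M borel_of Y"
proof (rule measurableI)
  fix C assume C: "C \<in> sets (borel_of Y)"
  have "f -` C \<inter> space (borel_of X) = (\<lambda>x. emeasure (K x) C) -` {1} \<inter> space (borel_of X)"
    using f C by (auto simp: indicator_def split: if_splits)
  then show "f -` C \<inter> space (borel_of X) \<in> sets (borel_of X)"
    using measurable_sets[OF stochastic_relation_measurable[OF K C], of "{1}"] by simp
qed (use f in auto)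

text \<open>Composing with a deterministic relation is pushing forward along its map: the integrand
  is the indicator of the preimage of \<open>C\<close>. This links composition to condition
  (2).\<close>

lemma emeasure_kleisli_return:
  assumes K: "stochastic_relation X Y K" and f: "f \<in> borel_of Y \<rightarrow>\<^sub>M borel_of Z"
    and x: "x \<in> topspace X" and C: "C \<in> sets (borel_of Z)"
  shows "emeasure (kleisli Z (\<lambda>y. return (borel_of Z) (f y)) K x) C =
    emeasure (K x) (f -` C \<inter> topspace Y)"
proof -
  have "emeasure (kleisli Z (\<lambda>y. return (borel_of Z) (f y)) K x) C =
      (\<integral>\<^sup>+ y. indicator (f -` C \<inter> topspace Y) y \<partial>K x)"
    unfolding emeasure_kleisli[OF K stochastic_relation_return[OF f] x C]
    by (rule nn_integral_cong)
       (use C in \<open>simp add: indicator_def stochastic_relation_space[OF K x]\<close>)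
  also have "\<dots> = emeasure (K x) (f -` C \<inter> topspace Y)"
    using measurable_sets[OF f C] by (simp add: stochastic_relation_sets[OF K x])
  finally show ?thesis .
qed

section \<open>Unit and associativity laws of Kleisli composition, and cancellation\<close>

lemma kleisli_return_id:
  assumes K: "stochastic_relation X Y K" and x: "x \<in> topspace X"
  shows "kleisli Y (return (borel_of Y)) K x = K x"
proof (rule measure_eqI)
  fix B assume "B \<in> sets (kleisli Y (return (borel_of Y)) K x)"
  then have B: "B \<in> sets (borel_of Y)" by simp
  then show "emeasure (kleisli Y (return (borel_of Y)) K x) B = emeasure (K x) B"
    using emeasure_kleisli_return[OF K measurable_ident x B] sets.sets_into_space[OF B]
    by (simp add: Int_absorb2)
qed (simp add: stochastic_relation_sets[OF K x])

lemma nn_integral_kleisli: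
  assumes K: "stochastic_relation X Y K" and L: "stochastic_relation Y Z L"
    and x: "x \<in> topspace X" and g: "g \<in> borel_measurable (borel_of Z)"
  shows "(\<integral>\<^sup>+ z. g z \<partial>kleisli Z L K x) = (\<integral>\<^sup>+ y. \<integral>\<^sup>+ z. g z \<partial>L y \<partial>K x)"
proof -
  \<comment> \<open>\<open>kleisli_eq_bind\<close> gives access to the Giry monad only for nonempty
    middle and target spaces; the two empty cases are settled directly.\<close>
  consider "topspace Z = {}" | "topspace Y = {}" | "topspace Y \<noteq> {}" "topspace Z \<noteq> {}" by blast
  then show ?thesis
  proof cases
    case 1
    then have "(\<integral>\<^sup>+ z. g z \<partial>L y) = 0" if "y \<in> space (K x)" for y
      using that stochastic_relation_space[OF K x] stochastic_relation_space[OF L]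
      by (simp add: nn_integral_empty)
    then have "(\<integral>\<^sup>+ y. \<integral>\<^sup>+ z. g z \<partial>L y \<partial>K x) = 0"
      by (simp cong: nn_integral_cong)
    with 1 show ?thesis by (simp add: nn_integral_empty)
  next
    case 2
    then have sp: "space (K x) = {}" by (simp add: stochastic_relation_space[OF K x])
    \<comment> \<open>Here \<open>topspace Z\<close> may have points, but the composite is the zero
      measure, so \<open>g\<close> vanishes almost everywhere.\<close>
    have "emeasure (kleisli Z L K x) (topspace Z) = 0"
      using sp by (simp add: emeasure_kleisli[OF K L x] nn_integral_empty)
    then have "topspace Z \<in> null_sets (kleisli Z L K x)" by (simp add: null_sets_def)
    then have "AE z in kleisli Z L K x. g z = 0" by (rule AE_I') auto
    then have "(\<integral>\<^sup>+ z. g z \<partial>kleisli Z L K x) = 0"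
      using nn_integral_cong_AE[of g "\<lambda>_. 0"] by simp
    with sp show ?thesis by (simp add: nn_integral_empty)
  next
    case 3
    note s = stochastic_relation_sets[OF K x]
    have L': "L \<in> K x \<rightarrow>\<^sub>M subprob_algebra (borel_of Z)"
      using L stochastic_relation_iff_measurable[OF 3(2)]
      unfolding measurable_cong_sets[OF s refl] by blast
    show ?thesis
      unfolding kleisli_eq_bind[OF K L x 3] by (rule nn_integral_bind[OF g L'])
  qed
qed

lemma kleisli_assoc:
  assumes K: "stochastic_relation X Y K" and L: "stochastic_relation Y Z L"
    and M: "stochastic_relation Z W M" and x: "x \<in> topspace X"
  shows "kleisli W M (kleisli Z L K) x = kleisli W (kleisli W M L) K x"
proof (rule measure_eqI)
  fix C assume "C \<in> sets (kleisli W M (kleisli Z L K) x)"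
  then have C: "C \<in> sets (borel_of W)" by simp
  have "emeasure (kleisli W M (kleisli Z L K) x) C = (\<integral>\<^sup>+ y. \<integral>\<^sup>+ z. emeasure (M z) C \<partial>L y \<partial>K x)"
    unfolding emeasure_kleisli[OF stochastic_relation_kleisli[OF K L] M x C]
    by (rule nn_integral_kleisli[OF K L x stochastic_relation_measurable[OF M C]])
  also have "\<dots> = (\<integral>\<^sup>+ y. emeasure (kleisli W M L y) C \<partial>K x)"
    by (rule nn_integral_cong)
       (simp add: stochastic_relation_space[OF K x] emeasure_kleisli[OF L M _ C])
  also have "\<dots> = emeasure (kleisli W (kleisli W M L) K x) C"
    by (rule emeasure_kleisli[OF K stochastic_relation_kleisli[OF L M] x C, symmetric])
  finally show "emeasure (kleisli W M (kleisli Z L K) x) C =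
    emeasure (kleisli W (kleisli W M L) K x) C" .
qed simp

text \<open>By associativity, \<open>J * J'\<close> after \<open>K\<close> is \<open>J * L\<close>,
  which is \<open>K\<close> again. So \<open>J * J'\<close> and the identity relation
  \<open>return\<close> agree after \<open>K\<close>, and the epimorphism \<open>K\<close> can be
  cancelled.\<close>

lemma epimorphism_retract:
  assumes Y: "Polish_space Y" and epi: "epimorphism X Y K"
    and K: "stochastic_relation X Y K"
    and J: "stochastic_relation Z Y J" and J': "stochastic_relation Y Z J'"
    and KJ: "\<And>x. x \<in> topspace X \<Longrightarrow> K x = kleisli Y J L x"
    and LJ: "\<And>x. x \<in> topspace X \<Longrightarrow> L x = kleisli Z J' K x"
    and y: "y \<in> topspace Y"
  shows "kleisli Y J J' y = return (borel_of Y) y"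
proof (rule epimorphism_cancel[OF epi K Y _ _ _ y])
  show "stochastic_relation Y Y (kleisli Y J J')"
    by (rule stochastic_relation_kleisli[OF J' J])
  show "stochastic_relation Y Y (return (borel_of Y))"
    using stochastic_relation_return[OF measurable_ident, of Y] by simp
  fix x assume x: "x \<in> topspace X"
  have "kleisli Y (kleisli Y J J') K x = kleisli Y J (kleisli Z J' K) x"
    by (rule kleisli_assoc[OF K J' J x, symmetric])
  \<comment> \<open>\<open>L\<close> equals the composite only at points of
    \<open>topspace X\<close>. Unfolding \<open>kleisli\<close> shows that only the value at
    \<open>x\<close> enters.\<close>
  also have "\<dots> = kleisli Y J L x" by (simp add: kleisli_def[of Y J] LJ[OF x])
  also have "\<dots> = kleisli Y (return (borel_of Y)) K x"
    by (simp add: KJ[OF x, symmetric] kleisli_return_id[OF K x])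
  finally show "kleisli Y (kleisli Y J J') K x = kleisli Y (return (borel_of Y)) K x" .
qed

section \<open>Point masses forced by extremal integrals\<close>

lemma AE_eq_1_if_nn_integral_eq_1:
  fixes f :: "'a \<Rightarrow> ennreal"
  assumes f: "f \<in> borel_measurable M" and le: "\<And>x. x \<in> space M \<Longrightarrow> f x \<le> 1"
    and M: "emeasure M (space M) \<le> 1" and int: "(\<integral>\<^sup>+ x. f x \<partial>M) = 1"
  shows "AE x in M. f x = 1"
proof -
  \<comment> \<open>Splitting the integral is allowed since that of \<open>f\<close> is finite. The
    result is the total mass minus 1, and truncated subtraction makes it 0.\<close>
  have "(\<integral>\<^sup>+ x. 1 - f x \<partial>M) = (\<integral>\<^sup>+ x. 1 \<partial>M) - (\<integral>\<^sup>+ x. f x \<partial>M)"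
    by (rule nn_integral_diff) (use f le int in auto)
  also have "\<dots> = 0" using M int diff_eq_0_ennreal[of "emeasure M (space M)" 1]
    by (simp add: order_le_less_trans)
  finally have "AE x in M. 1 - f x = 0"
    using f by (subst (asm) nn_integral_0_iff_AE) auto
  then show ?thesis
  proof (rule AE_mp, intro AE_I2 impI)
    fix x assume "x \<in> space M" "1 - f x = 0"
    then have "1 \<le> f x" by (simp add: diff_eq_0_iff_ennreal)
    with le[OF \<open>x \<in> space M\<close>] show "f x = 1" by (rule antisym)
  qed
qed

text \<open>The point \<open>y\<close> already uses up the whole permitted mass 1, so by additivity
  nothing is left for sets avoiding \<open>y\<close>.\<close>

lemma eq_return_if_singleton:
  assumes s: "sets M = sets N" and y: "{y} \<in> sets N"
    and le: "emeasure M (space M) \<le> 1" and eq: "emeasure M {y} = 1"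
  shows "M = return N y"
proof (rule measure_eqI)
  fix B assume B: "B \<in> sets M"
  have ym: "{y} \<in> sets M" using s y by simp
  show "emeasure M B = emeasure (return N y) B"
  proof (cases "y \<in> B")
    case True
    then have "1 \<le> emeasure M B" using eq B emeasure_mono[of "{y}" B M] by simp
    moreover have "emeasure M B \<le> 1" using le emeasure_space order_trans by blast
    ultimately have "emeasure M B = 1" by simp
    then show ?thesis using True B s by simp
  next
    case False
    have "1 + emeasure M B = emeasure M ({y} \<union> B)"
      using plus_emeasure[OF ym B] False eq by simp
    also have "\<dots> \<le> 1 + 0" using le emeasure_space[of M "{y} \<union> B"] by simp
    finally have "emeasure M B = 0" by (simp add: ennreal_add_left_cancel_le)
    then show ?thesis using False B s by simp
  qed
qed (simp add: s)

text \<open>Evaluating \<open>id\<close> on \<open>{y}\<close> gives an integral equal to 1, the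
  largest value that subprobabilities allow. Being nonzero, this integral also prevents the first
  conclusion from holding vacuously, which yields the second.\<close>

lemma retract_AE_return:
  assumes Y: "Polish_space Y"
    and J: "stochastic_relation Z Y J" and J': "stochastic_relation Y Z J'"
    and y: "y \<in> topspace Y" and id: "kleisli Y J J' y = return (borel_of Y) y"
  shows "AE z in J' y. J z = return (borel_of Y) y"
    and "\<exists>z\<in>topspace Z. J z = return (borel_of Y) y"
proof -
  note sy = singleton_in_borel_of[OF Y y]
  note sp = stochastic_relation_space[OF J' y]
  have int: "(\<integral>\<^sup>+ z. emeasure (J z) {y} \<partial>J' y) = 1"
    using emeasure_kleisli[OF J' J y sy] id sy by simp
  have "AE z in J' y. emeasure (J z) {y} = 1"
  proof (rule AE_eq_1_if_nn_integral_eq_1[OF _ _ _ int])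
    show "(\<lambda>z. emeasure (J z) {y}) \<in> borel_measurable (J' y)"
      unfolding measurable_cong_sets[OF stochastic_relation_sets[OF J' y] refl]
      by (rule stochastic_relation_measurable[OF J sy])
    show "emeasure (J z) {y} \<le> 1" if "z \<in> space (J' y)" for z
      using that sp stochastic_relation_le_1[OF J] by simp
    show "emeasure (J' y) (space (J' y)) \<le> 1" by (rule stochastic_relation_le_1[OF J' y])
  qed
  then show ae: "AE z in J' y. J z = return (borel_of Y) y"
  proof (rule AE_mp, intro AE_I2 impI)
    fix z assume z: "z \<in> space (J' y)" "emeasure (J z) {y} = 1"
    then have "z \<in> topspace Z" using sp by simp
    then show "J z = return (borel_of Y) y"
      using z(2) by (intro eq_return_if_singleton sy stochastic_relation_sets[OF J]
          stochastic_relation_le_1[OF J])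
  qed
  show "\<exists>z\<in>topspace Z. J z = return (borel_of Y) y"
  proof (rule ccontr)
    assume "\<not> ?thesis"
    then have "AE z in J' y. J z \<noteq> return (borel_of Y) y"
      by (intro AE_I2) (auto simp: sp)
    \<comment> \<open>Contradictory properties hold almost everywhere, so any property does; the
      value 0 is chosen to make the integral in \<open>int\<close> vanish.\<close>
    with ae have "AE z in J' y. emeasure (J z) {y} = 0" by eventually_elim simp
    then have "(\<integral>\<^sup>+ z. emeasure (J z) {y} \<partial>J' y) = 0"
      using nn_integral_cong_AE[of "\<lambda>z. emeasure (J z) {y}" "\<lambda>_. 0"] by simp
    with int show False by simp
  qed
qed

text \<open>The point carries positive mass, so no null set can contain it.\<close>

lemma AE_return_point:
  assumes "AE x in return N y. P x" and "y \<in> space N"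
  shows "P y"
proof (rule ccontr)
  assume "\<not> P y"
  obtain A where A: "{x \<in> space (return N y). \<not> P x} \<subseteq> A"
    "emeasure (return N y) A = 0" "A \<in> sets (return N y)"
    using assms(1) by (rule AE_E)
  then have "y \<in> A" using \<open>\<not> P y\<close> assms(2) by auto
  then show False using A by simp
qed

section \<open>From mutually inverse relations to a Borel isomorphism\<close>

lemma inverse_relations_return:
  assumes Y: "Polish_space Y" and Z: "Polish_space Z"
    and J: "stochastic_relation Z Y J" and J': "stochastic_relation Y Z J'"
    and idY: "\<And>y. y \<in> topspace Y \<Longrightarrow> kleisli Y J J' y = return (borel_of Y) y"
    and idZ: "\<And>z. z \<in> topspace Z \<Longrightarrow> kleisli Z J' J z = return (borel_of Z) z"
    and y: "y \<in> topspace Y"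
  shows "\<exists>z\<in>topspace Z. J z = return (borel_of Y) y \<and> J' y = return (borel_of Z) z"
proof -
  obtain z where z: "z \<in> topspace Z" "J z = return (borel_of Y) y"
    using retract_AE_return(2)[OF Y J J' y idY[OF y]] by blast
  have "AE y' in return (borel_of Y) y. J' y' = return (borel_of Z) z"
    using retract_AE_return(1)[OF Z J' J z(1) idZ[OF z(1)]] unfolding z(2) .
  then have "J' y = return (borel_of Z) z" by (rule AE_return_point) (simp add: y)
  with z show ?thesis by blast
qed

lemma inverse_relations_borel_isomorphism:
  assumes Y: "Polish_space Y" and Z: "Polish_space Z"
    and J: "stochastic_relation Z Y J" and J': "stochastic_relation Y Z J'"
    and idY: "\<And>y. y \<in> topspace Y \<Longrightarrow> kleisli Y J J' y = return (borel_of Y) y"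
    and idZ: "\<And>z. z \<in> topspace Z \<Longrightarrow> kleisli Z J' J z = return (borel_of Z) z"
  obtains f where "borel_isomorphism Y Z f"
    "\<And>y. y \<in> topspace Y \<Longrightarrow> J' y = return (borel_of Z) (f y)"
proof -
  obtain f where f: "\<And>y. y \<in> topspace Y \<Longrightarrow> f y \<in> topspace Z \<and>
      J (f y) = return (borel_of Y) y \<and> J' y = return (borel_of Z) (f y)"
    using inverse_relations_return[OF Y Z J J' idY idZ] by metis
  obtain g where g: "\<And>z. z \<in> topspace Z \<Longrightarrow> g z \<in> topspace Y \<and>
      J' (g z) = return (borel_of Z) z \<and> J z = return (borel_of Y) (g z)"
    using inverse_relations_return[OF Z Y J' J idZ idY] by metis
  \<comment> \<open>\<open>J (f y)\<close> is the point mass at \<open>y\<close> by the choice of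
    \<open>f\<close> and at \<open>g (f y)\<close> by the choice of \<open>g\<close>; equal point
    masses sit at equal points.\<close>
  have gf: "g (f y) = y" if "y \<in> topspace Y" for y
    using return_borel_of_inj[OF Y] f g that by metis
  have fg: "f (g z) = z" if "z \<in> topspace Z" for z
    using return_borel_of_inj[OF Z] f g that by metis
  have bij: "bij_betw f (topspace Y) (topspace Z)"
    using f g gf fg by (intro bij_betw_byWitness[where f' = g]) auto
  have "the_inv_into (topspace Y) f z = g z" if "z \<in> topspace Z" for z
    using bij g fg that by (intro the_inv_into_f_eq) (auto simp: bij_betw_def)
  \<comment> \<open>The inverse agrees with \<open>g\<close>, which represents \<open>J\<close>, so
    its measurability is that of \<open>J\<close>; for \<open>f\<close> it is that of
    \<open>J'\<close>.\<close>
  then have "the_inv_into (topspace Y) f \<in> borel_of Z \<rightarrow>\<^sub>M borel_of Y"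
    using g by (intro measurable_if_return_relation[OF J]) simp
  moreover have "f \<in> borel_of Y \<rightarrow>\<^sub>M borel_of Z"
    using f by (intro measurable_if_return_relation[OF J']) simp
  ultimately have "borel_isomorphism Y Z f" using bij by (simp add: borel_isomorphism_def)
  then show ?thesis using f that by blast
qed

theorem proposition2p215:
  fixes X :: "'a topology" and Y :: "'b topology" and Z :: "'c topology"
    and K :: "'a \<Rightarrow> 'b measure" and L :: "'a \<Rightarrow> 'c measure"
  assumes "Polish_space X" and "Polish_space Y" and "Polish_space Z"
    and "stochastic_relation X Y K" and "stochastic_relation X Z L"
    and "epimorphism X Y K" and "epimorphism X Z L"
  shows "relation_equiv X Y Z K L \<longleftrightarrow>
    (\<exists>f. borel_isomorphism Y Z f \<and>
         (\<forall>x\<in>topspace X. \<forall>C\<in>sets (borel_of Z).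
            emeasure (L x) C = emeasure (K x) (f -` C \<inter> topspace Y)))"
proof
  note Y = assms(2) and Z = assms(3) and K = assms(4) and L = assms(5)
  assume "relation_equiv X Y Z K L"
  then obtain J J' where J: "stochastic_relation Z Y J" and J': "stochastic_relation Y Z J'"
    and KJ: "\<And>x. x \<in> topspace X \<Longrightarrow> K x = kleisli Y J L x"
    and LJ: "\<And>x. x \<in> topspace X \<Longrightarrow> L x = kleisli Z J' K x"
    unfolding relation_equiv_def relation_le_def by blast
  obtain f where f: "borel_isomorphism Y Z f"
    and J'f: "\<And>y. y \<in> topspace Y \<Longrightarrow> J' y = return (borel_of Z) (f y)"
    using inverse_relations_borel_isomorphism[OF Y Z J J'
        epimorphism_retract[OF Y assms(6) K J J' KJ LJ]
        epimorphism_retract[OF Z assms(7) L J' J LJ KJ]]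
    by blast
  have fm: "f \<in> borel_of Y \<rightarrow>\<^sub>M borel_of Z" using f by (simp add: borel_isomorphism_def)
  have "emeasure (L x) C = emeasure (K x) (f -` C \<inter> topspace Y)"
    if x: "x \<in> topspace X" and C: "C \<in> sets (borel_of Z)" for x C
  proof -
    have "emeasure (L x) C = (\<integral>\<^sup>+ y. emeasure (J' y) C \<partial>K x)"
      unfolding LJ[OF x] by (rule emeasure_kleisli[OF K J' x C])
    also have "\<dots> = (\<integral>\<^sup>+ y. emeasure (return (borel_of Z) (f y)) C \<partial>K x)"
      by (rule nn_integral_cong) (simp add: stochastic_relation_space[OF K x] J'f)
    also have "\<dots> = emeasure (K x) (f -` C \<inter> topspace Y)"
      using emeasure_kleisli_return[OF K fm x C]
      by (simp only: emeasure_kleisli[OF K stochastic_relation_return[OF fm] x C])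
    finally show ?thesis .
  qed
  with f show "\<exists>f. borel_isomorphism Y Z f \<and> (\<forall>x\<in>topspace X. \<forall>C\<in>sets (borel_of Z).
      emeasure (L x) C = emeasure (K x) (f -` C \<inter> topspace Y))" by blast
next
  note K = assms(4) and L = assms(5)
  assume "\<exists>f. borel_isomorphism Y Z f \<and> (\<forall>x\<in>topspace X. \<forall>C\<in>sets (borel_of Z).
      emeasure (L x) C = emeasure (K x) (f -` C \<inter> topspace Y))"
  then obtain f where iso: "borel_isomorphism Y Z f"
    and LK: "\<And>x C. x \<in> topspace X \<Longrightarrow> C \<in> sets (borel_of Z) \<Longrightarrow>
      emeasure (L x) C = emeasure (K x) (f -` C \<inter> topspace Y)" by blast
  define g where "g = the_inv_into (topspace Y) f"
  have f: "f \<in> borel_of Y \<rightarrow>\<^sub>M borel_of Z" and g: "g \<in> borel_of Z \<rightarrow>\<^sub>M borel_of Y"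
    and bij: "bij_betw f (topspace Y) (topspace Z)"
    using iso by (auto simp: borel_isomorphism_def g_def)
  have gf: "g (f y) = y" if "y \<in> topspace Y" for y
    using bij that by (simp add: g_def bij_betw_def the_inv_into_f_f)
  \<comment> \<open>The witnesses for the two inequalities are the deterministic relations of
    \<open>g\<close> and \<open>f\<close>. Here (2) is applied to the preimage of \<open>B\<close>
    under \<open>g\<close>, which \<open>f\<close> pulls back to \<open>B\<close>.\<close>
  have "K x = kleisli Y (\<lambda>z. return (borel_of Y) (g z)) L x" if x: "x \<in> topspace X" for x
  proof (rule measure_eqI)
    fix B assume "B \<in> sets (K x)"
    then have B: "B \<in> sets (borel_of Y)" by (simp add: stochastic_relation_sets[OF K x])
    have "f -` (g -` B \<inter> topspace Z) \<inter> topspace Y = B"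
      using gf bij_betwE[OF bij] sets.sets_into_space[OF B] by auto
    then show "emeasure (K x) B = emeasure (kleisli Y (\<lambda>z. return (borel_of Y) (g z)) L x) B"
      using LK[OF x, of "g -` B \<inter> topspace Z"] measurable_sets[OF g B]
      by (simp add: emeasure_kleisli_return[OF L g x B])
  qed (simp add: stochastic_relation_sets[OF K x])
  moreover have "L x = kleisli Z (\<lambda>y. return (borel_of Z) (f y)) K x" if x: "x \<in> topspace X" for x
    by (rule measure_eqI)
       (simp_all add: stochastic_relation_sets[OF L x] emeasure_kleisli_return[OF K f x] LK[OF x])
  ultimately show "relation_equiv X Y Z K L"
    unfolding relation_equiv_def relation_le_def
    using stochastic_relation_return[OF f] stochastic_relation_return[OF g] by blast
qed

end
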